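(* Let $M[P,Q]$ have rank $r$ and nullity $m$. Every nontrivial connected flat $X$ of $M[P,Q]$ is an interval in $[m+r]$, and $n(X)$ is an interval of $r(X)$ elements in $[r]$.
   Context: Lattice paths start at $(0,0)$ and use steps $E=(1,0)$ and $N=(0,1)$. For lattice paths $P,Q$ from $(0,0)$ to $(m,r)$ with $P$ never going above $Q$, let $\mathcal{P}$ be the set of lattice paths from $(0,0)$ to $(m,r)$ going neither above $Q$ nor below $P$, and for $1\le i\le r$ let $N_i=\{j:\text{step } j \text{ is the } i\text{-th North step of some path in }\mathcal{P}\}$. $M[P,Q]$ is the transversal matroid on $[m+r]$ with presentation $(N_1,\ldots,N_r)$; its incidence function is $n(X)=\{i\in[r]: X\cap N_i\neq\emptyset\}$. A flat $X$ is connected if $M|X$ is connected, and nontrivial if $X$ is dependent. *)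

theory Defs
  imports Main
begin

section \<open>Matroids, given by their independent sets\<close>

record 'a matroid =
  ground :: "'a set"
  indep :: "'a set \<Rightarrow> bool"

definition dependent :: "'a matroid \<Rightarrow> 'a set \<Rightarrow> bool" where
  "dependent M X \<longleftrightarrow> X \<subseteq> ground M \<and> \<not> indep M X"

definition circuit :: "'a matroid \<Rightarrow> 'a set \<Rightarrow> bool" where
  "circuit M C \<longleftrightarrow> dependent M C \<and> (\<forall>D. D \<subset> C \<longrightarrow> indep M D)"

definition rank :: "'a matroid \<Rightarrow> 'a set \<Rightarrow> nat" where
  "rank M X = Max {card Y | Y. Y \<subseteq> X \<and> indep M Y}"

definition closure :: "'a matroid \<Rightarrow> 'a set \<Rightarrow> 'a set" where
  "closure M X = {e \<in> ground M. rank M (insert e X) = rank M X}"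

definition flat :: "'a matroid \<Rightarrow> 'a set \<Rightarrow> bool" where
  "flat M X \<longleftrightarrow> X \<subseteq> ground M \<and> closure M X = X"

definition restriction :: "'a matroid \<Rightarrow> 'a set \<Rightarrow> 'a matroid" where
  "restriction M X = \<lparr>ground = X, indep = (\<lambda>Y. Y \<subseteq> X \<and> indep M Y)\<rparr>"

definition connected :: "'a matroid \<Rightarrow> bool" where
  "connected M \<longleftrightarrow>
     (\<forall>x\<in>ground M. \<forall>y\<in>ground M. x \<noteq> y \<longrightarrow> (\<exists>C. circuit M C \<and> x \<in> C \<and> y \<in> C))"

definition connected_flat :: "'a matroid \<Rightarrow> 'a set \<Rightarrow> bool" where
  "connected_flat M X \<longleftrightarrow> flat M X \<and> connected (restriction M X)"

definition nontrivial_flat :: "'a matroid \<Rightarrow> 'a set \<Rightarrow> bool" where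
  "nontrivial_flat M X \<longleftrightarrow> flat M X \<and> dependent M X"

text \<open>The transversal matroid on \<open>S\<close> with presentation \<open>(A i)\<close>, \<open>i \<in> I\<close>: the independent
  sets are the partial transversals. The sets \<open>A i\<close> need not be distinct.\<close>

definition partial_transversal :: "'i set \<Rightarrow> ('i \<Rightarrow> 'a set) \<Rightarrow> 'a set \<Rightarrow> bool" where
  "partial_transversal I A X \<longleftrightarrow> (\<exists>\<phi>. inj_on \<phi> X \<and> (\<forall>x\<in>X. \<phi> x \<in> I \<and> x \<in> A (\<phi> x)))"

definition transversal_matroid :: "'a set \<Rightarrow> 'i set \<Rightarrow> ('i \<Rightarrow> 'a set) \<Rightarrow> 'a matroid" where
  "transversal_matroid S I A =
     \<lparr>ground = S, indep = (\<lambda>X. X \<subseteq> S \<and> partial_transversal I A X)\<rparr>"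

definition incidence :: "'i set \<Rightarrow> ('i \<Rightarrow> 'a set) \<Rightarrow> 'a set \<Rightarrow> 'i set" where
  "incidence I A X = {i \<in> I. X \<inter> A i \<noteq> {}}"


section \<open>Lattice paths\<close>

datatype step = East | North

definition lattice_path :: "nat \<Rightarrow> nat \<Rightarrow> step list \<Rightarrow> bool" where
  "lattice_path m r P \<longleftrightarrow> count_list P East = m \<and> count_list P North = r"

text \<open>After \<open>k\<close> steps, all paths from the origin are on the same antidiagonal \<open>x + y = k\<close>, so one
  path never goes above another iff it is never higher after the same number of steps.\<close>

definition never_above :: "step list \<Rightarrow> step list \<Rightarrow> bool" where
  "never_above P Q \<longleftrightarrow> (\<forall>k. count_list (take k P) North \<le> count_list (take k Q) North)"

definition paths_between :: "nat \<Rightarrow> nat \<Rightarrow> step list \<Rightarrow> step list \<Rightarrow> step list set" where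
  "paths_between m r P Q = {R. lattice_path m r R \<and> never_above R Q \<and> never_above P R}"

text \<open>Steps are numbered from \<open>1\<close>, whereas list positions start at \<open>0\<close>.\<close>

definition is_nth_north :: "step list \<Rightarrow> nat \<Rightarrow> nat \<Rightarrow> bool" where
  "is_nth_north R i j \<longleftrightarrow>
     1 \<le> j \<and> j \<le> length R \<and> R ! (j - 1) = North \<and> count_list (take j R) North = i"

definition north_set :: "nat \<Rightarrow> nat \<Rightarrow> step list \<Rightarrow> step list \<Rightarrow> nat \<Rightarrow> nat set" where
  "north_set m r P Q i = {j. \<exists>R \<in> paths_between m r P Q. is_nth_north R i j}"

definition lattice_path_matroid :: "nat \<Rightarrow> nat \<Rightarrow> step list \<Rightarrow> step list \<Rightarrow> nat matroid" where
  "lattice_path_matroid m r P Q = transversal_matroid {1..m + r} {1..r} (north_set m r P Q)"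

text \<open>The empty set counts as an interval: if a flat consists of a single loop, its rank is \<open>0\<close>
  and its incidence set is empty.\<close>

definition interval_in :: "nat \<Rightarrow> nat set \<Rightarrow> bool" where
  "interval_in n X \<longleftrightarrow> X \<subseteq> {1..n} \<and> (\<exists>a b. X = {a..b})"

end

theory Submission
  imports Defs
begin

text \<open>
  A step \<open>j\<close> lies in \<open>N i\<close> iff the height of \<open>P\<close> before step \<open>j\<close> is less than \<open>i\<close> and the height
  of \<open>Q\<close> after step \<open>j\<close> is at least \<open>i\<close>; so every \<open>n {j}\<close> is an interval whose two endpoints are
  monotone in \<open>j\<close>. By Hall's theorem a circuit \<open>C\<close> of a transversal matroid satisfies
  \<open>card (n C) = card C - 1\<close>, and applying this to fundamental circuits gives \<open>card (n X) = rank X\<close>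
  for every union \<open>X\<close> of circuits. A gap in \<open>n X\<close> would split the elements of \<open>X\<close> into two parts
  with disjoint incidence sets, and no circuit could meet both parts. Finally, as \<open>X\<close> is a flat and
  \<open>card (n X) = rank X\<close>, it consists of all \<open>j\<close> with \<open>n {j} \<subseteq> n X\<close>, which form an interval by the
  monotonicity of the endpoints.
\<close>

section \<open>Partial transversals\<close>

lemma incidence_mono: "X \<subseteq> Y \<Longrightarrow> incidence I A X \<subseteq> incidence I A Y"
  unfolding incidence_def by blast

lemma incidence_Un: "incidence I A (X \<union> Y) = incidence I A X \<union> incidence I A Y"
  unfolding incidence_def by blast

lemma incidence_Diff: "incidence (I - J) A X = incidence I A X - J"
  unfolding incidence_def by blast

lemma finite_incidence: "finite I \<Longrightarrow> finite (incidence I A X)"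
  unfolding incidence_def by simp

lemma partial_transversal_empty [simp]: "partial_transversal I A {}"
  unfolding partial_transversal_def by simp

lemma partial_transversal_mono:
  assumes "partial_transversal I A X" "Y \<subseteq> X" "I \<subseteq> J"
  shows "partial_transversal J A Y"
  using assms unfolding partial_transversal_def by (meson inj_on_subset subsetD)

lemma partial_transversal_Un:
  assumes "partial_transversal I A X" "partial_transversal J A Y" "I \<inter> J = {}"
  shows "partial_transversal (I \<union> J) A (X \<union> Y)"
proof -
  obtain f g where f: "inj_on f X" "\<forall>x\<in>X. f x \<in> I \<and> x \<in> A (f x)"
    and g: "inj_on g Y" "\<forall>x\<in>Y. g x \<in> J \<and> x \<in> A (g x)"
    using assms unfolding partial_transversal_def by blast
  \<comment> \<open>On \<open>X \<inter> Y\<close> the matching of \<open>X\<close> takes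
    precedence; a clash between \<open>f\<close> and \<open>g\<close> would need a common
    index.\<close>
  let ?h = "\<lambda>x. if x \<in> X then f x else g x"
  have "inj_on ?h (X \<union> Y)"
    unfolding inj_on_def using f g assms(3)
    by (smt (verit, best) IntI Un_iff empty_iff inj_onD)
  moreover have "\<forall>x\<in>X \<union> Y. ?h x \<in> I \<union> J \<and> x \<in> A (?h x)"
    using f g by auto
  ultimately show ?thesis unfolding partial_transversal_def by blast
qed

text \<open>Provides the disjoint index sets that \<open>partial_transversal_Un\<close> asks
  for.\<close>

lemma partial_transversal_incidence:
  "partial_transversal I A X \<Longrightarrow> partial_transversal (incidence I A X) A X"
  unfolding partial_transversal_def incidence_def by blast

lemma card_le_incidence:
  assumes "finite I" "partial_transversal I A X"
  shows "card X \<le> card (incidence I A X)"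
proof -
  obtain f where f: "inj_on f X" "\<forall>x\<in>X. f x \<in> I \<and> x \<in> A (f x)"
    using assms unfolding partial_transversal_def by blast
  have "f ` X \<subseteq> incidence I A X"
    using f unfolding incidence_def by blast
  with f(1) show ?thesis
    by (metis assms(1) card_image card_mono finite_incidence)
qed

text \<open>Induction on \<open>X\<close>. If a nonempty proper subset is tight, it uses up its
  incidence set and the rest is matched outside; otherwise there is slack, and any single admissible
  pair can be split off.\<close>

theorem hall:
  assumes "finite X" "finite I" "\<And>Y. Y \<subseteq> X \<Longrightarrow> card Y \<le> card (incidence I A Y)"
  shows "partial_transversal I A X"
  using assms
proof (induction X arbitrary: I rule: finite_psubset_induct)
  case (psubset X)
  note fI = psubset.prems(1) and hall = psubset.prems(2)
  show ?case
  proof (cases "\<exists>Y. Y \<subset> X \<and> Y \<noteq> {} \<and> card (incidence I A Y) = card Y")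
    case True
    then obtain Y where Y: "Y \<subset> X" "Y \<noteq> {}" "card (incidence I A Y) = card Y" by blast
    let ?J = "incidence I A Y"
    have finY: "finite Y" using Y psubset.hyps finite_subset by blast
    have 1: "partial_transversal I A Y"
      using psubset.IH[OF Y(1) fI] hall Y(1) by blast
    have 2: "partial_transversal (I - ?J) A (X - Y)"
    proof (rule psubset.IH)
      show "X - Y \<subset> X" using Y by blast
      show "finite (I - ?J)" using fI by simp
      fix Z assume Z: "Z \<subseteq> X - Y"
      have finZ: "finite Z" using Z psubset.hyps finite_subset by blast
      \<comment> \<open>Hall's condition for \<open>Z\<close> is the one for
        \<open>Z \<union> Y\<close> minus the equality for the tight set \<open>Y\<close>.\<close>
      have "card Z + card Y = card (Z \<union> Y)"
        using Z finY finZ by (subst card_Un_disjoint) auto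
      also have "\<dots> \<le> card (incidence I A (Z \<union> Y))"
        using hall Z Y(1) by (metis Diff_subset Un_subset_iff psubset_imp_subset subset_trans)
      also have "\<dots> = card (incidence (I - ?J) A Z) + card ?J"
        unfolding incidence_Diff incidence_Un
        by (subst card_Un_disjoint [symmetric]) (auto simp: finite_incidence fI)
      finally show "card Z \<le> card (incidence (I - ?J) A Z)" using Y(3) by simp
    qed
    have "partial_transversal (?J \<union> (I - ?J)) A (Y \<union> (X - Y))"
      using partial_transversal_Un[OF partial_transversal_incidence[OF 1] 2] by blast
    then show ?thesis
      by (rule partial_transversal_mono) (auto simp: incidence_def)
  next
    case False
    show ?thesis
    proof (cases "X = {}")
      case nonempty: False
      then obtain x where x: "x \<in> X" by blast
      have "card {x} \<le> card (incidence I A {x})" using hall x by blast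
      then have "incidence I A {x} \<noteq> {}" by auto
      then obtain i where i: "i \<in> I" "x \<in> A i" unfolding incidence_def by blast
      have 1: "partial_transversal {i} A {x}"
        using i unfolding partial_transversal_def by (intro exI[of _ "\<lambda>_. i"]) auto
      have 2: "partial_transversal (I - {i}) A (X - {x})"
      proof (rule psubset.IH)
        show "X - {x} \<subset> X" using x by blast
        show "finite (I - {i})" using fI by simp
        fix Z assume Z: "Z \<subseteq> X - {x}"
        show "card Z \<le> card (incidence (I - {i}) A Z)"
        proof (cases "Z = {}")
          case nZ: False
          have "Z \<subset> X" using Z x by blast
          \<comment> \<open>No tight subset, so \<open>Z\<close> has a spare index that pays for the
            loss of \<open>i\<close>.\<close>
          then have "card Z < card (incidence I A Z)"
            using False nZ hall by (metis nat_less_le psubset_imp_subset)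
          moreover have "card (incidence I A Z) \<le> Suc (card (incidence I A Z - {i}))"
            by (metis One_nat_def add_Suc_right card_Diff1_le card_Suc_Diff1 diff_le_self
                finite_incidence fI le_Suc_eq Diff_empty Diff_insert0 order_refl)
          ultimately show ?thesis unfolding incidence_Diff by linarith
        qed simp
      qed
      have "partial_transversal ({i} \<union> (I - {i})) A ({x} \<union> (X - {x}))"
        using partial_transversal_Un[OF 1 2] by blast
      then show ?thesis
        by (rule partial_transversal_mono) (use i in auto)
    qed simp
  qed
qed


section \<open>Transversal matroids\<close>

lemma ground_transversal_matroid [simp]: "ground (transversal_matroid S I A) = S"
  unfolding transversal_matroid_def by simp

lemma indep_transversal_matroid [simp]:
  "indep (transversal_matroid S I A) X \<longleftrightarrow> X \<subseteq> S \<and> partial_transversal I A X"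
  unfolding transversal_matroid_def by simp

lemma circuit_transversal_iff:
  "circuit (transversal_matroid S I A) C \<longleftrightarrow>
     C \<subseteq> S \<and> \<not> partial_transversal I A C \<and> (\<forall>D. D \<subset> C \<longrightarrow> partial_transversal I A D)"
  unfolding circuit_def dependent_def by auto

lemma circuit_restriction_iff:
  assumes "X \<subseteq> ground M"
  shows "circuit (restriction M X) C \<longleftrightarrow> circuit M C \<and> C \<subseteq> X"
  using assms unfolding circuit_def dependent_def restriction_def by auto

text \<open>Proper subsets of \<open>C\<close> meet Hall's condition, so \<open>C\<close> itself
  must violate it; removing one element leaves a matchable set, so the deficiency is exactly
  one.\<close>

lemma circuit_incidence:
  assumes "finite S" "finite I" "circuit (transversal_matroid S I A) C"
  shows "Suc (card (incidence I A C)) = card C"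
proof -
  have C: "C \<subseteq> S" "\<not> partial_transversal I A C" "\<And>D. D \<subset> C \<Longrightarrow> partial_transversal I A D"
    using assms(3) unfolding circuit_transversal_iff by auto
  have finC: "finite C" using C(1) assms(1) finite_subset by blast
  have less: "card (incidence I A C) < card C"
  proof (rule ccontr)
    assume "\<not> ?thesis"
    then have "card Y \<le> card (incidence I A Y)" if "Y \<subseteq> C" for Y
      using that C(3) card_le_incidence[OF assms(2)] by (metis leI psubsetI)
    then show False using hall[OF finC assms(2)] C(2) by blast
  qed
  have "C \<noteq> {}" using C(2) by auto
  then obtain x where x: "x \<in> C" by blast
  have "card (C - {x}) \<le> card (incidence I A (C - {x}))"
    using C(3) x by (intro card_le_incidence assms) auto
  also have "\<dots> \<le> card (incidence I A C)"
    by (intro card_mono incidence_mono finite_incidence assms) auto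
  finally have "card C \<le> Suc (card (incidence I A C))"
    using x finC by simp
  with less show ?thesis by linarith
qed

section \<open>Circuits and rank from independent sets alone\<close>

lemma dependent_contains_circuit:
  assumes "finite X" "dependent M X"
  obtains C where "circuit M C" "C \<subseteq> X"
  using assms
proof (induction X arbitrary: thesis rule: finite_psubset_induct)
  case (psubset X)
  show ?case
  proof (cases "circuit M X")
    case False
    then obtain D where "D \<subset> X" "dependent M D"
      using psubset.prems(2) unfolding circuit_def dependent_def by blast
    moreover obtain C where "circuit M C" "C \<subseteq> D"
      using psubset.IH[OF calculation(1) _ calculation(2)] by blast
    ultimately show ?thesis using psubset.prems(1)[of C] by blast
  qed (use psubset.prems in blast)
qed

lemma finite_indep_cards: "finite X \<Longrightarrow> finite {card Y | Y. Y \<subseteq> X \<and> indep M Y}"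
  by (rule finite_subset[of _ "card ` Pow X"]) auto

lemma card_le_rank:
  assumes "finite X" "Y \<subseteq> X" "indep M Y"
  shows "card Y \<le> rank M X"
  unfolding rank_def using assms by (intro Max_ge finite_indep_cards) auto

lemma rank_witness:
  assumes "finite X" "indep M {}"
  obtains B where "B \<subseteq> X" "indep M B" "card B = rank M X"
proof -
  have "rank M X \<in> {card Y | Y. Y \<subseteq> X \<and> indep M Y}"
    unfolding rank_def using assms by (intro Max_in finite_indep_cards) auto
  with that show thesis by auto
qed

lemma rank_le_incidence:
  assumes "finite X" "finite I"
  shows "rank (transversal_matroid S I A) X \<le> card (incidence I A X)"
proof -
  obtain B where B: "B \<subseteq> X" "partial_transversal I A B"
    "card B = rank (transversal_matroid S I A) X"
    by (rule rank_witness[OF assms(1), of "transversal_matroid S I A"]) auto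
  have "card B \<le> card (incidence I A B)" using B card_le_incidence assms by blast
  also have "\<dots> \<le> card (incidence I A X)"
    by (intro card_mono incidence_mono finite_incidence assms B)
  finally show ?thesis using B by simp
qed

lemma rank_union_of_circuits:
  fixes S :: "'a set" and I :: "'i set" and A :: "'i \<Rightarrow> 'a set"
  defines "M \<equiv> transversal_matroid S I A"
  assumes "finite S" "finite I" "X \<subseteq> S"
    and cov: "\<And>x. x \<in> X \<Longrightarrow> \<exists>C. circuit M C \<and> C \<subseteq> X \<and> x \<in> C"
  shows "card (incidence I A X) = rank M X"
proof (rule antisym)
  have finX: "finite X" using assms finite_subset by blast
  show "rank M X \<le> card (incidence I A X)"
    unfolding M_def by (rule rank_le_incidence[OF finX assms(3)])
  obtain B where B: "B \<subseteq> X" "indep M B" "card B = rank M X"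
    by (rule rank_witness[OF finX, of M]) (auto simp: M_def)
  have finB: "finite B" using B(1) finX finite_subset by blast
  obtain f where f: "inj_on f B" "\<And>x. x \<in> B \<Longrightarrow> f x \<in> I \<and> x \<in> A (f x)"
    using B(2) unfolding M_def by (auto simp: partial_transversal_def)
  have "\<exists>C. circuit M C \<and> C \<subseteq> insert e B \<and> e \<in> C" if e: "e \<in> X - B" for e
  proof -
    have "\<not> indep M (insert e B)"
      using card_le_rank[OF finX, of "insert e B" M] e B finB by auto
    then have "dependent M (insert e B)"
      using e B assms(4) unfolding dependent_def M_def by auto
    then obtain C where C: "circuit M C" "C \<subseteq> insert e B"
      using dependent_contains_circuit finB by (metis finite_insert)
    \<comment> \<open>The circuit must use \<open>e\<close>, since \<open>B\<close> is independent:
      it is a fundamental circuit of \<open>e\<close>.\<close>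
    have "\<not> C \<subseteq> B"
      using C(1) B(2) partial_transversal_mono[of I A B C I]
      unfolding M_def circuit_transversal_iff by auto
    with C show ?thesis by blast
  qed
  then obtain K where K: "\<And>e. e \<in> X - B \<Longrightarrow> circuit M (K e) \<and> K e \<subseteq> insert e B \<and> e \<in> K e"
    by metis
  \<comment> \<open>One inclusion is clear, and both sides have \<open>card (K e) - 1\<close>
    elements.\<close>
  have nK: "incidence I A (K e) = f ` (K e - {e})" if e: "e \<in> X - B" for e
  proof -
    have sub: "K e - {e} \<subseteq> B" using K e by blast
    have "finite (K e)" using K[OF e] finB finite_subset by (metis finite_insert)
    then have "card (f ` (K e - {e})) = card (K e) - 1"
      using K[OF e] by (simp add: card_image inj_on_subset[OF f(1) sub])
    also have "\<dots> = card (incidence I A (K e))"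
      using circuit_incidence[OF assms(2,3)] K[OF e] unfolding M_def by (metis diff_Suc_1)
    finally have "card (f ` (K e - {e})) = card (incidence I A (K e))" .
    moreover have "f ` (K e - {e}) \<subseteq> incidence I A (K e)"
      using f(2) sub unfolding incidence_def by blast
    ultimately show ?thesis
      by (metis assms(3) card_subset_eq finite_incidence)
  qed
  \<comment> \<open>\<open>B'\<close> is the part of the basis covered by fundamental circuits, and
    \<open>?X1\<close> is the union of these circuits.\<close>
  define B' where "B' = (\<Union>e\<in>X - B. K e - {e})"
  let ?X1 = "(X - B) \<union> B'"
  have B'B: "B' \<subseteq> B" using K unfolding B'_def by blast
  have nX1: "incidence I A ?X1 \<subseteq> f ` B'"
  proof
    fix i assume "i \<in> incidence I A ?X1"
    then obtain x where x: "x \<in> ?X1" "i \<in> I" "x \<in> A i" unfolding incidence_def by blast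
    then obtain e where e: "e \<in> X - B" "x \<in> K e" using K unfolding B'_def by blast
    then have "i \<in> incidence I A (K e)" using x unfolding incidence_def by blast
    then show "i \<in> f ` B'" using nK[OF e(1)] e(1) unfolding B'_def by blast
  qed
  \<comment> \<open>A circuit through an element of \<open>B - B'\<close> would be independent: its part in \<open>?X1\<close> can be
    matched into \<open>f ` B'\<close>, and \<open>f\<close> matches the rest outside \<open>f ` B'\<close>.\<close>
  have "B \<subseteq> B'"
  proof (rule ccontr)
    assume "\<not> B \<subseteq> B'"
    then obtain b where b: "b \<in> B" "b \<notin> B'" by blast
    then obtain D where D: "circuit M D" "D \<subseteq> X" "b \<in> D" using cov B(1) by blast
    have "D \<inter> ?X1 \<subset> D" using b D(3) by blast
    then have "partial_transversal I A (D \<inter> ?X1)"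
      using D(1) unfolding M_def circuit_transversal_iff by blast
    moreover have "incidence I A (D \<inter> ?X1) \<subseteq> f ` B'"
      by (rule order.trans[OF incidence_mono nX1]) blast
    ultimately have 1: "partial_transversal (f ` B') A (D \<inter> ?X1)"
      by (blast intro: partial_transversal_mono[OF partial_transversal_incidence])
    have sub: "D - ?X1 \<subseteq> B - B'" using D(2) by blast
    have 2: "partial_transversal (f ` (B - B')) A (D - ?X1)"
      unfolding partial_transversal_def using sub f
      by (intro exI[of _ f]) (auto intro: inj_on_subset)
    have disj: "f ` B' \<inter> f ` (B - B') = {}"
      using inj_on_image_Int[OF f(1) B'B, of "B - B'"] by blast
    have "partial_transversal (f ` B' \<union> f ` (B - B')) A (D \<inter> ?X1 \<union> (D - ?X1))"
      by (rule partial_transversal_Un[OF 1 2 disj])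
    then have "partial_transversal I A D"
      by (rule partial_transversal_mono) (use f(2) B'B in auto)
    then show False using D(1) unfolding M_def circuit_transversal_iff by blast
  qed
  then have "X \<subseteq> ?X1" by blast
  then have "incidence I A X \<subseteq> f ` B"
    using nX1 B'B incidence_mono[of X ?X1 I A] by blast
  then have "card (incidence I A X) \<le> card (f ` B)"
    by (intro card_mono) (use finB in auto)
  also have "\<dots> \<le> rank M X" using B(3) card_image_le[OF finB] by simp
  finally show "card (incidence I A X) \<le> rank M X" .
qed

text \<open>Otherwise the two proper parts of \<open>C\<close> would be matched into disjoint index
  sets, and the matchings would combine to one of \<open>C\<close>.\<close>

lemma circuit_not_split:
  assumes "circuit (transversal_matroid S I A) C" "C \<subseteq> Y \<union> Z" "C \<inter> Y \<noteq> {}" "C \<inter> Z \<noteq> {}"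
  shows "incidence I A Y \<inter> incidence I A Z \<noteq> {} \<or> Y \<inter> Z \<noteq> {}"
proof (rule ccontr)
  assume "\<not> ?thesis"
  then have disj: "incidence I A Y \<inter> incidence I A Z = {}" and YZ: "Y \<inter> Z = {}" by auto
  have "C \<inter> Y \<subset> C" "C \<inter> Z \<subset> C" using assms YZ by blast+
  then have "partial_transversal I A (C \<inter> Y)" "partial_transversal I A (C \<inter> Z)"
    using assms(1) unfolding circuit_transversal_iff by blast+
  then have "partial_transversal (incidence I A (C \<inter> Y) \<union> incidence I A (C \<inter> Z)) A
      (C \<inter> Y \<union> C \<inter> Z)"
    using disj incidence_mono[of "C \<inter> Y" Y I A] incidence_mono[of "C \<inter> Z" Z I A]
    by (intro partial_transversal_Un partial_transversal_incidence) auto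
  then have "partial_transversal I A C"
    by (rule partial_transversal_mono) (use assms(2) in \<open>auto simp: incidence_def\<close>)
  then show False using assms(1) unfolding circuit_transversal_iff by blast
qed


section \<open>Connected flats for monotone interval presentations\<close>

lemma interval_if_no_gap:
  fixes J :: "nat set"
  assumes "finite J" "\<And>i j k. i \<in> J \<Longrightarrow> k \<in> J \<Longrightarrow> i \<le> j \<Longrightarrow> j \<le> k \<Longrightarrow> j \<in> J"
  shows "\<exists>a b. J = {a..b}"
proof (cases "J = {}")
  case True
  then show ?thesis by (intro exI[of _ 1] exI[of _ 0]) simp
next
  case False
  have "Min J \<in> J" "Max J \<in> J" using assms(1) False by simp_all
  then have "{Min J..Max J} \<subseteq> J" using assms(2)[of "Min J" "Max J"] by (intro subsetI) simp
  moreover have "J \<subseteq> {Min J..Max J}" using assms(1) by auto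
  ultimately have "J = {Min J..Max J}" by blast
  then show ?thesis by blast
qed

text \<open>Isolates what is used about lattice paths: each element of the ground set is incident
  with an interval of indices whose endpoints are monotone. The interval may be empty, which makes
  the element a loop.\<close>

theorem connected_flat_interval:
  fixes A :: "nat \<Rightarrow> nat set" and lo hi :: "nat \<Rightarrow> nat" and n r :: nat
  defines "M \<equiv> transversal_matroid {1..n} {1..r} A"
  assumes A: "\<And>i j. i \<in> {1..r} \<Longrightarrow> j \<in> {1..n} \<Longrightarrow> j \<in> A i \<longleftrightarrow> lo j \<le> i \<and> i \<le> hi j"
    and mono: "mono lo" "mono hi"
    and range: "\<And>j. j \<in> {1..n} \<Longrightarrow> 1 \<le> lo j \<and> hi j \<le> r"
    and conn: "connected_flat M X" and nontriv: "nontrivial_flat M X"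
  shows "interval_in n X \<and> interval_in r (incidence {1..r} A X)
    \<and> card (incidence {1..r} A X) = rank M X"
proof -
  let ?I = "{1..r}"
  let ?n = "incidence ?I A"
  have XS: "X \<subseteq> {1..n}" using conn unfolding connected_flat_def flat_def M_def by simp
  have finX: "finite X" using XS finite_subset by blast
  have dep: "\<not> partial_transversal ?I A X"
    using nontriv XS unfolding nontrivial_flat_def dependent_def M_def by auto
  have nsub: "?n X \<subseteq> ?I" unfolding incidence_def by blast
  have pair: "\<exists>C. circuit M C \<and> C \<subseteq> X \<and> x \<in> C \<and> y \<in> C"
    if "x \<in> X" "y \<in> X" "x \<noteq> y" for x y
    using conn that circuit_restriction_iff[of X M] XS
    unfolding connected_flat_def connected_def by (fastforce simp: restriction_def M_def)
  have n1: "?n {j} = {lo j..hi j}" if "j \<in> {1..n}" for j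
    using A[OF _ that] range[OF that] unfolding incidence_def by fastforce
  have "X \<noteq> {}" using dep by auto
  then obtain x where x: "x \<in> X" by blast
  show ?thesis
  \<comment> \<open>Connectedness yields circuits only through two distinct elements. A dependent
    singleton is a loop, so its incidence set is empty and its rank is \<open>0\<close>.\<close>
  proof (cases "X = {x}")
    case True
    have "\<exists>C. circuit M C \<and> C \<subseteq> X"
      using dependent_contains_circuit[OF finX] nontriv unfolding nontrivial_flat_def by metis
    then obtain C where C: "circuit M C" "C \<subseteq> X" by blast
    have "Suc (card (?n C)) = card C"
      using C(1) circuit_incidence unfolding M_def by (metis finite_atLeastAtMost)
    moreover have "C \<noteq> {}" using calculation by auto
    then have "C = X" using C(2) True by auto
    ultimately have 0: "?n X = {}" using True nsub by (simp add: finite_incidence)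
    have "rank M X = 0" using rank_le_incidence[OF finX, of ?I "{1..n}" A] 0 unfolding M_def by simp
    moreover have "X = {x..x}" "?n X = {1..0}" using True 0 by auto
    ultimately show ?thesis using XS nsub 0 unfolding interval_in_def by (metis card.empty)
  next
    case False
    have other: "\<exists>z\<in>X. z \<noteq> y" for y using False x by (cases "x = y") auto
    have rk: "card (?n X) = rank M X"
      unfolding M_def
    proof (rule rank_union_of_circuits)
      fix y assume "y \<in> X"
      with other[of y] pair
      show "\<exists>C. circuit (transversal_matroid {1..n} ?I A) C \<and> C \<subseteq> X \<and> y \<in> C"
        unfolding M_def by blast
    qed (use XS in auto)
    \<comment> \<open>A loop cannot lie properly inside a circuit, but some circuit contains
      \<open>y\<close> and a second element.\<close>
    have noloop: "lo y \<le> hi y" if y: "y \<in> X" for y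
    proof (rule ccontr)
      assume "\<not> ?thesis"
      then have e: "?n {y} = {}" using n1 XS y by auto
      obtain z where z: "z \<in> X" "z \<noteq> y" using other by blast
      obtain C where C: "circuit M C" "y \<in> C" "z \<in> C" using pair[OF y z(1)] z by metis
      have "{y} \<subset> C" using C z by blast
      then have "partial_transversal ?I A {y}"
        using C(1) unfolding M_def circuit_transversal_iff by blast
      then show False using card_le_incidence[of ?I A "{y}"] e by simp
    qed
    have "\<exists>c d. ?n X = {c..d}"
    proof (rule interval_if_no_gap)
      show "finite (?n X)" by (simp add: finite_incidence)
      fix i g k assume ik: "i \<in> ?n X" "k \<in> ?n X" "i \<le> g" "g \<le> k"
      show "g \<in> ?n X"
      proof (rule ccontr)
        assume g: "g \<notin> ?n X"
        have gI: "g \<in> ?I" using ik nsub by auto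
        \<comment> \<open>The interval of \<open>y\<close> misses \<open>g\<close>, so it lies
          entirely on one side of it.\<close>
        have side: "hi y < g \<or> g < lo y" if "y \<in> X" for y
        proof -
          have "y \<notin> A g" using g gI that unfolding incidence_def by blast
          then show ?thesis using A[OF gI, of y] that XS by auto
        qed
        let ?Y = "{y \<in> X. hi y < g}" and ?Z = "{y \<in> X. g < lo y}"
        obtain y where y: "y \<in> X" "i \<in> ?I" "y \<in> A i" using ik(1) unfolding incidence_def by blast
        obtain z where z: "z \<in> X" "k \<in> ?I" "z \<in> A k" using ik(2) unfolding incidence_def by blast
        have yz: "y \<in> ?Y" "z \<in> ?Z"
          using side[OF y(1)] side[OF z(1)] A[OF y(2), of y] A[OF z(2), of z] y z XS ik(3,4) by auto
        have YZ: "?Y \<inter> ?Z = {}" using noloop by force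
        have "?n ?Y \<inter> ?n ?Z = {}"
        proof -
          have "h < g" if "h \<in> ?n ?Y" for h
            using that A XS unfolding incidence_def by fastforce
          moreover have "g < h" if "h \<in> ?n ?Z" for h
            using that A XS unfolding incidence_def by fastforce
          ultimately show ?thesis by force
        qed
        moreover have "y \<noteq> z" using yz YZ by blast
        then obtain C where C: "circuit M C" "C \<subseteq> X" "y \<in> C" "z \<in> C"
          using pair[OF y(1) z(1)] by blast
        have "C \<subseteq> ?Y \<union> ?Z" using C(2) side by blast
        ultimately show False
          using circuit_not_split[of "{1..n}" ?I A C ?Y ?Z] C yz YZ unfolding M_def by blast
      qed
    qed
    then obtain c d where cd: "?n X = {c..d}" by blast
    \<comment> \<open>Adding \<open>e\<close> keeps the incidence set, whose size bounds the rank
      and is already attained by \<open>X\<close>; hence \<open>e\<close> is in the closure.\<close>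
    have absorb: "e \<in> X" if e: "e \<in> {1..n}" "?n {e} \<subseteq> ?n X" for e
    proof -
      have "?n (insert e X) = ?n X"
        using e(2) incidence_Un[of ?I A "{e}" X] by auto
      then have "rank M (insert e X) \<le> rank M X"
        using rank_le_incidence[of "insert e X" ?I "{1..n}" A] finX rk unfolding M_def by simp
      moreover have "rank M X \<le> rank M (insert e X)"
      proof -
        obtain B where "B \<subseteq> X" "indep M B" "card B = rank M X"
          by (rule rank_witness[OF finX, of M]) (auto simp: M_def)
        then show ?thesis using card_le_rank[of "insert e X" B M] finX by auto
      qed
      ultimately have "e \<in> closure M X" using e unfolding closure_def M_def by simp
      then show ?thesis using conn unfolding connected_flat_def flat_def by simp
    qed
    \<comment> \<open>Inclusion of intervals bounds the endpoints because \<open>noloop\<close>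
      makes the smaller one nonempty.\<close>
    have bounds: "c \<le> lo y \<and> hi y \<le> d" if y: "y \<in> X" for y
    proof -
      have "?n {y} \<subseteq> ?n X" using y by (intro incidence_mono) auto
      then show ?thesis using cd n1[of y] noloop[OF y] y XS by auto
    qed
    have "\<exists>a b. X = {a..b}"
    proof (rule interval_if_no_gap[OF finX])
      fix i j k assume ijk: "i \<in> X" "k \<in> X" "i \<le> j" "j \<le> k"
      have j: "j \<in> {1..n}" using ijk XS by auto
      have "c \<le> lo j" using bounds[OF ijk(1)] monoD[OF mono(1) ijk(3)] by linarith
      moreover have "hi j \<le> d" using bounds[OF ijk(2)] monoD[OF mono(2) ijk(4)] by linarith
      ultimately show "j \<in> X" using absorb[OF j] n1[OF j] cd by auto
    qed
    then show ?thesis using rk XS nsub cd unfolding interval_in_def by blast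
  qed
qed


section \<open>Lattice paths\<close>

text \<open>The second coordinate after \<open>k\<close> steps; past the end of the path it keeps
  its final value.\<close>

abbreviation height :: "step list \<Rightarrow> nat \<Rightarrow> nat" where
  "height R k \<equiv> count_list (take k R) North"

lemma count_East_North: "count_list R East + count_list R North = length R"
proof (induction R)
  case (Cons s R)
  then show ?case by (cases s) auto
qed simp

lemma length_lattice_path: "lattice_path m r R \<Longrightarrow> length R = m + r"
  using count_East_North[of R] unfolding lattice_path_def by simp

lemma height_Suc:
  "height R (Suc k) = height R k + (if k < length R \<and> R ! k = North then 1 else 0)"
  by (cases "k < length R") (auto simp: take_Suc_conv_app_nth)

lemma mono_height: "mono (height R)"
  unfolding mono_iff_le_Suc height_Suc by simp

lemma height_le: "j \<le> k \<Longrightarrow> height R j \<le> height R k"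
  using mono_height by (rule monoD)

lemma height_end: "lattice_path m r R \<Longrightarrow> m + r \<le> k \<Longrightarrow> height R k = r"
  using length_lattice_path[of m r R] by (simp add: lattice_path_def)

text \<open>Lets paths be constructed through their heights: the increments of \<open>h\<close>
  dictate the steps, with list position \<open>k\<close> holding step \<open>k + 1\<close>.\<close>

lemma path_of_height:
  assumes "h 0 = 0" "\<And>k. h (Suc k) = h k \<or> h (Suc k) = Suc (h k)" "\<And>k. m + r \<le> k \<Longrightarrow> h k = r"
  shows "\<exists>R. lattice_path m r R \<and> (\<forall>k. height R k = h k)"
proof -
  let ?R = "map (\<lambda>k. if h (Suc k) = Suc (h k) then North else East) [0..<m + r]"
  have ht: "height ?R k = h k" for k
  proof (induction k)
    case (Suc k)
    show ?case
    proof (cases "k < m + r")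
      case True
      then show ?thesis using Suc assms(2)[of k] by (auto simp: height_Suc)
    next
      case False
      then show ?thesis using Suc assms(3)[of k] assms(3)[of "Suc k"] by (simp add: height_Suc)
    qed
  qed (simp add: assms)
  have "count_list ?R North = r" using ht[of "m + r"] assms(3)[of "m + r"] by simp
  then have "lattice_path m r ?R"
    using count_East_North[of ?R] unfolding lattice_path_def by simp
  with ht show ?thesis by blast
qed

text \<open>A North step is a jump in height; \<open>Suc\<close> on the left avoids truncated
  subtraction at \<open>i = 0\<close>.\<close>

lemma is_nth_north_iff:
  "is_nth_north R i j \<longleftrightarrow> 1 \<le> j \<and> j \<le> length R \<and> height R j = i \<and> Suc (height R (j - 1)) = i"
  unfolding is_nth_north_def using height_Suc[of "j - 1" R] by (auto split: if_splits)

text \<open>A path making its \<open>i\<close>-th North step at \<open>j\<close> passes from height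
  \<open>i - 1\<close> to \<open>i\<close> there, which \<open>P\<close> and \<open>Q\<close> must
  allow. Conversely, a path doing so is obtained by clamping these two heights between
  \<open>P\<close> and \<open>Q\<close>.\<close>

lemma north_set_eq:
  assumes P: "lattice_path m r P" and Q: "lattice_path m r Q" and PQ: "never_above P Q"
  shows "north_set m r P Q i = {j \<in> {1..m + r}. height P (j - 1) < i \<and> i \<le> height Q j}"
proof (intro set_eqI iffI)
  fix j assume "j \<in> north_set m r P Q i"
  then obtain R where R: "lattice_path m r R" "never_above R Q" "never_above P R"
      "is_nth_north R i j"
    unfolding north_set_def paths_between_def by blast
  have "height P (j - 1) \<le> height R (j - 1)" "height R j \<le> height Q j"
    using R unfolding never_above_def by blast+
  then show "j \<in> {j \<in> {1..m + r}. height P (j - 1) < i \<and> i \<le> height Q j}"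
    using R(4) length_lattice_path[OF R(1)] unfolding is_nth_north_iff by auto
next
  fix j assume "j \<in> {j \<in> {1..m + r}. height P (j - 1) < i \<and> i \<le> height Q j}"
  then have j: "1 \<le> j" "j \<le> m + r" "height P (j - 1) < i" "i \<le> height Q j" by auto
  have PQk: "height P k \<le> height Q k" for k using PQ unfolding never_above_def by blast
  \<comment> \<open>Stay as close to height \<open>i - 1\<close> as possible before step \<open>j\<close>, and to height \<open>i\<close> after it.\<close>
  define h where "h k = max (height P k) (min (height Q k) (if k < j then i - 1 else i))" for k
  \<comment> \<open>Heights grow by at most one per step, so \<open>Q\<close> permits height
    \<open>i - 1\<close> before step \<open>j\<close> and \<open>P\<close> permits height
    \<open>i\<close> after it: the clamping changes nothing there.\<close>
  have Qj: "i \<le> Suc (height Q (j - 1))"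
    using j height_Suc[of "j - 1" Q] by (auto split: if_splits)
  have Pj: "height P j \<le> i"
    using j height_Suc[of "j - 1" P] by (auto split: if_splits)
  have hj: "h (j - 1) = i - 1" "h j = i" unfolding h_def using j Qj Pj by auto
  have "\<exists>R. lattice_path m r R \<and> (\<forall>k. height R k = h k)"
  proof (rule path_of_height)
    show "h 0 = 0" unfolding h_def by simp
    show "h k = r" if "m + r \<le> k" for k
      unfolding h_def using height_end[OF P that] height_end[OF Q that] by simp
    show "h (Suc k) = h k \<or> h (Suc k) = Suc (h k)" for k
    proof (cases "Suc k = j")
      case True
      then show ?thesis using hj j by auto
    next
      case False
      \<comment> \<open>Away from step \<open>j\<close> the target height is constant, and
        \<open>min\<close> and \<open>max\<close> preserve increments of \<open>0\<close> or
        \<open>1\<close>.\<close>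
      then have "Suc k < j \<longleftrightarrow> k < j" by auto
      then show ?thesis unfolding h_def height_Suc by (auto simp: max_def min_def)
    qed
  qed
  then obtain R where R: "lattice_path m r R" "\<And>k. height R k = h k" by blast
  have "never_above R Q" "never_above P R"
    unfolding never_above_def R(2) using PQk by (auto simp: h_def)
  moreover have "is_nth_north R i j"
    unfolding is_nth_north_iff R(2) using hj j length_lattice_path[OF R(1)] by auto
  ultimately show "j \<in> north_set m r P Q i"
    using R(1) unfolding north_set_def paths_between_def by blast
qed

theorem theorem3p11:
  fixes m r :: nat and P Q :: "step list" and X :: "nat set"
  assumes "lattice_path m r P" and "lattice_path m r Q" and "never_above P Q"
    and "connected_flat (lattice_path_matroid m r P Q) X"
    and "nontrivial_flat (lattice_path_matroid m r P Q) X"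
  shows "interval_in (m + r) X
    \<and> interval_in r (incidence {1..r} (north_set m r P Q) X)
    \<and> card (incidence {1..r} (north_set m r P Q) X) = rank (lattice_path_matroid m r P Q) X"
  using assms(4,5) unfolding lattice_path_matroid_def
proof (intro connected_flat_interval)
  \<comment> \<open>\<open>Suc\<close> turns the strict bound from \<open>P\<close> into a weak one.
    At \<open>j = 0\<close> the truncated \<open>j - 1\<close> is \<open>0\<close>, so monotonicity
    holds on all of \<open>nat\<close>.\<close>
  let ?lo = "\<lambda>j. Suc (height P (j - 1))"
  show "mono ?lo"
    by (intro monoI) (simp add: height_le diff_le_mono)
  show "mono (height Q)" by (rule mono_height)
  show "j \<in> north_set m r P Q i \<longleftrightarrow> ?lo j \<le> i \<and> i \<le> height Q j"
    if "i \<in> {1..r}" "j \<in> {1..m + r}" for i j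
    using that unfolding north_set_eq[OF assms(1-3)] by auto
  show "1 \<le> ?lo j \<and> height Q j \<le> r" if "j \<in> {1..m + r}" for j
    using that height_le[of j "m + r" Q] height_end[OF assms(2), of "m + r"] by simp
qed

end
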